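(* Let $T=[0,\infty)$ or $T=[0,1)$, and let $K:T\times T\to\mathbb{R}$ be the kernel $K(s,t)=s\wedge t=\min(s,t)$ (the covariance kernel of standard Brownian motion). Then there is no countable discrete subset $S\subset T$ such that the linear span of $\{K(\cdot,s)\}_{s\in S}$ is dense in the reproducing kernel Hilbert space $\mathscr{H}(K)$.
   Context: For a positive definite kernel $K$ on $T\times T$, $\mathscr{H}(K)$ denotes its reproducing kernel Hilbert space: the Hilbert space of functions on $T$ that contains every $K(\cdot,t)$, $t\in T$, has the span of these functions as a dense subspace, and satisfies $f(t)=\langle K(\cdot,t),f\rangle_{\mathscr{H}(K)}$ for all $f\in\mathscr{H}(K)$, $t\in T$. The set $T$ carries its usual topology as a subset of $\mathbb{R}$; a subset $S\subset T$ is discrete if its subspace topology is discrete. *)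

theory Defs
  imports "HOL-Analysis.Analysis" "HOL-Library.Function_Algebras"
begin

text \<open>
  A real function on a set \<open>T\<close> of elements of type \<open>'a\<close> is represented by the function
  of type \<open>'a \<Rightarrow> real\<close> that extends it by zero outside \<open>T\<close>.
\<close>

definition fun_scale :: "real \<Rightarrow> ('a \<Rightarrow> real) \<Rightarrow> 'a \<Rightarrow> real"
  where "fun_scale c f = (\<lambda>x. c * f x)"

interpretation fun_space: vector_space "fun_scale :: real \<Rightarrow> ('a \<Rightarrow> real) \<Rightarrow> 'a \<Rightarrow> real"
  by unfold_locales (auto simp: fun_scale_def fun_eq_iff algebra_simps)

locale inner_product_function_space =
  fixes T :: "'a set"
    and H :: "('a \<Rightarrow> real) set"
    and ip :: "('a \<Rightarrow> real) \<Rightarrow> ('a \<Rightarrow> real) \<Rightarrow> real"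
  assumes subspace: "fun_space.subspace H"
    and zero_outside: "\<lbrakk>f \<in> H; t \<notin> T\<rbrakk> \<Longrightarrow> f t = 0"
    and ip_commute: "\<lbrakk>f \<in> H; g \<in> H\<rbrakk> \<Longrightarrow> ip f g = ip g f"
    and ip_add_left: "\<lbrakk>f \<in> H; g \<in> H; h \<in> H\<rbrakk> \<Longrightarrow> ip (f + g) h = ip f h + ip g h"
    and ip_scale_left: "\<lbrakk>f \<in> H; g \<in> H\<rbrakk> \<Longrightarrow> ip (fun_scale c f) g = c * ip f g"
    and ip_ge_zero: "f \<in> H \<Longrightarrow> 0 \<le> ip f f"
    and ip_eq_zero_imp: "\<lbrakk>f \<in> H; ip f f = 0\<rbrakk> \<Longrightarrow> f = 0"
begin

text \<open>
  The values of \<open>ip\<close> outside \<open>H\<close> are unconstrained, whereas \<^locale>\<open>Metric_space\<close>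
  requires symmetry and nonnegativity everywhere; hence the case distinction.
\<close>

definition hdist :: "('a \<Rightarrow> real) \<Rightarrow> ('a \<Rightarrow> real) \<Rightarrow> real"
  where "hdist f g = (if f \<in> H \<and> g \<in> H then sqrt (ip (f - g) (f - g)) else 0)"

lemma ip_add_right: "\<lbrakk>f \<in> H; g \<in> H; h \<in> H\<rbrakk> \<Longrightarrow> ip h (f + g) = ip h f + ip h g"
  by (metis fun_space.subspace_add ip_add_left ip_commute subspace)

lemma ip_scale_right: "\<lbrakk>f \<in> H; g \<in> H\<rbrakk> \<Longrightarrow> ip g (fun_scale c f) = c * ip g f"
  by (metis fun_space.subspace_scale ip_scale_left ip_commute subspace)

lemma ip_add_scale:
  assumes "f \<in> H" "g \<in> H"
  shows "ip (f + fun_scale c g) (f + fun_scale c g) = ip f f + 2 * c * ip f g + c\<^sup>2 * ip g g"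
proof -
  have cg: "fun_scale c g \<in> H"
    using assms fun_space.subspace_scale subspace by blast
  then have "f + fun_scale c g \<in> H"
    using assms fun_space.subspace_add subspace by blast
  then show ?thesis
    using assms cg ip_commute[of f g]
    by (simp add: ip_add_left ip_add_right ip_scale_left ip_scale_right
        algebra_simps power2_eq_square)
qed

lemma Cauchy_Schwarz:
  assumes "f \<in> H" "g \<in> H"
  shows "ip f g \<le> sqrt (ip f f) * sqrt (ip g g)"
proof (cases "ip g g = 0")
  case True
  then have "g = fun_scale 0 g"
    using ip_eq_zero_imp[OF assms(2)] by (simp add: fun_scale_def fun_eq_iff)
  then have "ip f g = 0"
    using ip_scale_right[OF assms(2,1), of 0] by simp
  then show ?thesis using True by simp
next
  case False
  then have pos: "ip g g > 0" using ip_ge_zero[OF assms(2)] by simp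
  define c where "c = - ip f g / ip g g"
  have "f + fun_scale c g \<in> H"
    using assms fun_space.subspace_scale fun_space.subspace_add subspace by metis
  then have "0 \<le> ip f f + 2 * c * ip f g + c\<^sup>2 * ip g g"
    using ip_ge_zero ip_add_scale[OF assms] by metis
  also have "\<dots> = ip f f - (ip f g)\<^sup>2 / ip g g"
    using pos unfolding c_def by (simp add: field_simps power2_eq_square)
  finally have "(ip f g)\<^sup>2 \<le> ip f f * ip g g"
    using pos by (simp add: field_simps)
  then have "ip f g \<le> sqrt (ip f f * ip g g)"
    by (rule real_le_rsqrt)
  then show ?thesis by (simp add: real_sqrt_mult)
qed

sublocale metric: Metric_space H hdist
proof
  have norm_neg: "ip (f - g) (f - g) = ip (g - f) (g - f)" if "f \<in> H" "g \<in> H" for f g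
  proof -
    have "f - g = fun_scale (-1) (g - f)" by (simp add: fun_scale_def fun_eq_iff)
    moreover have "g - f \<in> H" using that fun_space.subspace_diff subspace by blast
    ultimately show ?thesis
      by (metis fun_space.subspace_scale ip_scale_left ip_scale_right subspace
          mult_minus1 minus_minus)
  qed
  fix f g h
  show "0 \<le> hdist f g"
    using fun_space.subspace_diff[OF subspace] ip_ge_zero by (auto simp: hdist_def)
  show "hdist f g = hdist g f"
    using norm_neg by (auto simp: hdist_def)
  show "hdist f g = 0 \<longleftrightarrow> f = g" if "f \<in> H" "g \<in> H"
  proof -
    have "f - g \<in> H" using that fun_space.subspace_diff subspace by blast
    moreover have "ip 0 0 = 0"
      using ip_scale_left[of 0 0 0] fun_space.subspace_0[OF subspace]
      by (simp add: fun_scale_def zero_fun_def)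
    ultimately show ?thesis using that ip_eq_zero_imp[of "f - g"] by (auto simp: hdist_def)
  qed
  show "hdist f h \<le> hdist f g + hdist g h" if "f \<in> H" "g \<in> H" "h \<in> H"
  proof -
    define u v where "u = f - g" and "v = g - h"
    have uv: "u \<in> H" "v \<in> H"
      using that fun_space.subspace_diff subspace by (auto simp: u_def v_def)
    have "ip (u + v) (u + v) = ip u u + 2 * ip u v + ip v v"
      using ip_add_scale[OF uv, of 1] by (simp add: fun_scale_def)
    also have "\<dots> \<le> (sqrt (ip u u) + sqrt (ip v v))\<^sup>2"
      using Cauchy_Schwarz[OF uv] ip_ge_zero uv by (simp add: power2_sum)
    finally have "sqrt (ip (u + v) (u + v)) \<le> sqrt (ip u u) + sqrt (ip v v)"
      using ip_ge_zero uv by (simp add: real_le_lsqrt)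
    moreover have "u + v = f - h" by (simp add: u_def v_def)
    ultimately show ?thesis using that by (simp add: hdist_def u_def v_def)
  qed
qed

definition dense_in_space :: "('a \<Rightarrow> real) set \<Rightarrow> bool"
  where "dense_in_space A \<longleftrightarrow> A \<subseteq> H \<and> metric.mtopology closure_of A = H"

end

locale hilbert_function_space = inner_product_function_space +
  assumes complete: "metric.mcomplete"

definition kernel_section :: "'a set \<Rightarrow> ('a \<Rightarrow> 'a \<Rightarrow> real) \<Rightarrow> 'a \<Rightarrow> 'a \<Rightarrow> real"
  where "kernel_section T K t = (\<lambda>s. if s \<in> T then K s t else 0)"

text \<open>
  \<open>rkhs T H ip K\<close>: the space \<open>H\<close> with inner product \<open>ip\<close> is the reproducing kernel
  Hilbert space of \<open>K\<close> on \<open>T\<close>.  These conditions determine \<open>H\<close> and the restriction of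
  \<open>ip\<close> to \<open>H\<close> uniquely, and they force \<open>K\<close> to be symmetric and positive (semi)definite
  on \<open>T\<close>, since \<open>K s t\<close> is the inner product of the sections at \<open>s\<close> and \<open>t\<close>.
\<close>

locale rkhs = hilbert_function_space T H ip
  for T :: "'a set" and H :: "('a \<Rightarrow> real) set"
    and ip :: "('a \<Rightarrow> real) \<Rightarrow> ('a \<Rightarrow> real) \<Rightarrow> real" +
  fixes K :: "'a \<Rightarrow> 'a \<Rightarrow> real"
  assumes section_in: "t \<in> T \<Longrightarrow> kernel_section T K t \<in> H"
    and sections_dense: "dense_in_space (fun_space.span (kernel_section T K ` T))"
    and reproducing: "\<lbrakk>f \<in> H; t \<in> T\<rbrakk> \<Longrightarrow> f t = ip (kernel_section T K t) f"

end

theory Submission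
  imports Defs
begin

text \<open>
  An element \<open>f\<close> of the reproducing kernel Hilbert space vanishes on \<open>S\<close> iff it is orthogonal to
  every \<open>K(\<cdot>,s)\<close>, \<open>s \<in> S\<close>; if the span of these sections is dense, then \<open>f = 0\<close>.  A
  discrete set \<open>S\<close> misses some open interval \<open>(a,b)\<close> with end points in \<open>T\<close>, and with
  \<open>m = (a+b)/2\<close> the function \<open>K(\<cdot>,a) - 2 K(\<cdot>,m) + K(\<cdot>,b)\<close> is a nonzero tent supported on
  \<open>[a,b]\<close>, hence vanishes on \<open>S\<close>.
\<close>

context inner_product_function_space
begin

text \<open>By Pythagoras, every \<open>g\<close> in \<open>A\<close> lies at distance at least the
  norm of \<open>f\<close> from \<open>f\<close>; were \<open>f\<close> nonzero, density would
  supply a strictly closer \<open>g\<close>.\<close>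

lemma orthogonal_dense_imp_zero:
  assumes dense: "dense_in_space A" and f: "f \<in> H" and orth: "\<And>g. g \<in> A \<Longrightarrow> ip g f = 0"
  shows "f = 0"
proof (rule ccontr)
  assume "f \<noteq> 0"
  then have pos: "0 < ip f f"
    using f ip_eq_zero_imp ip_ge_zero by fastforce
  have "f \<in> metric.mtopology closure_of A"
    using dense f by (simp add: dense_in_space_def)
  then obtain g where g: "g \<in> A" "g \<in> H" "hdist f g < sqrt (ip f f)"
    using pos unfolding metric.metric_closure_of
    by (auto simp: metric.in_mball dest!: spec[of _ "sqrt (ip f f)"])
  have "f - g = f + fun_scale (-1) g"
    by (simp add: fun_scale_def fun_eq_iff)
  then have "ip (f - g) (f - g) = ip f f + ip g g"
    using ip_add_scale[OF f g(2), of "-1"] orth[OF g(1)] ip_commute[OF f g(2)] by simp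
  then have "sqrt (ip f f) \<le> hdist f g"
    using f g(2) ip_ge_zero[OF g(2)] by (simp add: hdist_def)
  then show False
    using g(3) by simp
qed

text \<open>The elements of \<open>H\<close> orthogonal to \<open>f\<close> form a subspace
  containing \<open>A\<close>.\<close>

lemma orthogonal_span:
  assumes f: "f \<in> H" and A: "A \<subseteq> H" and orth: "\<And>g. g \<in> A \<Longrightarrow> ip g f = 0"
    and g: "g \<in> fun_space.span A"
  shows "ip g f = 0"
proof -
  have "0 \<in> H"
    using fun_space.subspace_0[OF subspace] by (simp add: zero_fun_def)
  moreover have "ip 0 f = 0"
    using ip_scale_left[OF f f, of 0] by (simp add: fun_scale_def zero_fun_def)
  ultimately have "fun_space.subspace {h \<in> H. ip h f = 0}"
    using subspace f unfolding fun_space.subspace_def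
    by (auto simp: ip_add_left ip_scale_left)
  moreover have "A \<subseteq> {h \<in> H. ip h f = 0}"
    using A orth by auto
  ultimately show ?thesis
    using fun_space.span_minimal g by blast
qed

end

lemma (in rkhs) vanishing_imp_zero:
  assumes "S \<subseteq> T" and dense: "dense_in_space (fun_space.span (kernel_section T K ` S))"
    and f: "f \<in> H" and van: "\<And>s. s \<in> S \<Longrightarrow> f s = 0"
  shows "f = 0"
proof (rule orthogonal_dense_imp_zero[OF dense f])
  have "kernel_section T K ` S \<subseteq> H"
    using assms(1) section_in by auto
  moreover have "ip g f = 0" if "g \<in> kernel_section T K ` S" for g
    using that assms(1) f van reproducing by fastforce
  ultimately show "ip g f = 0" if "g \<in> fun_space.span (kernel_section T K ` S)" for g
    using orthogonal_span f that by blast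
qed

lemma discrete_subtopology_isolated:
  fixes S T :: "'a::metric_space set"
  assumes "subtopology (top_of_set T) S = discrete_topology S" and "S \<subseteq> T" and "s \<in> S"
  obtains e where "e > 0" and "\<And>x. x \<in> S \<Longrightarrow> dist x s < e \<Longrightarrow> x = s"
proof -
  \<comment> \<open>As \<open>S\<close> lies in \<open>T\<close>, restricting first to
    \<open>T\<close> and then to \<open>S\<close> gives the Euclidean subspace topology of
    \<open>S\<close>, so discreteness makes singletons open there.\<close>
  have "openin (top_of_set S) {s}"
    using assms by (metis discrete_topology_unique inf.absorb2 subtopology_subtopology
        topspace_discrete_topology openin_discrete_topology insert_subset empty_subsetI)
  then obtain e where "e > 0" "\<forall>x\<in>S. dist x s < e \<longrightarrow> x \<in> {s}"
    unfolding openin_euclidean_subtopology_iff by blast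
  then show ?thesis
    using that by auto
qed

text \<open>Immediately to the right of an isolated point \<open>s\<close> of \<open>S\<close> there
  is a gap in \<open>S\<close>, so \<open>s\<close> itself can serve as the left end point.\<close>

lemma discrete_misses_interval:
  fixes S T :: "real set"
  assumes T: "T = {0..} \<or> T = {0..<1}" and S: "S \<subseteq> T"
    and discrete: "subtopology (top_of_set T) S = discrete_topology S"
  obtains a b where "a \<in> T" "b \<in> T" "a < b" "S \<inter> {a<..<b} = {}"
proof (cases "S = {}")
  case True
  then show ?thesis
    using T by (intro that[of 0 "1/2"]) auto
next
  case False
  then obtain s where s: "s \<in> S" by blast
  then obtain e where e: "e > 0" "\<And>x. x \<in> S \<Longrightarrow> dist x s < e \<Longrightarrow> x = s"
    using discrete_subtopology_isolated[OF discrete S] by blast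
  \<comment> \<open>\<open>T\<close> has no largest element. Capping at \<open>c\<close> keeps the
    right end point \<open>min c (s + e)\<close> in \<open>T\<close>, which matters when
    \<open>T\<close> is \<open>{0..<1}\<close>.\<close>
  obtain c where c: "s < c" "c \<in> T"
  proof (cases "T = {0..}")
    case True
    then show ?thesis using s S by (intro that[of "s + 1"]) auto
  next
    case False
    then show ?thesis using T s S by (intro that[of "(s + 1) / 2"]) auto
  qed
  show ?thesis
  proof
    show "s \<in> T" using s S by auto
    show "min c (s + e) \<in> T" using T c e(1) \<open>s \<in> T\<close> by auto
    show "s < min c (s + e)" using c e(1) by simp
    show "S \<inter> {s<..<min c (s + e)} = {}"
    proof -
      have False if "x \<in> S" "s < x" "x < s + e" for x
        using e(2)[of x] that by (simp add: dist_real_def)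
      then show ?thesis by auto
    qed
  qed
qed

theorem theorem2p5:
  fixes T :: "real set"
    and K :: "real \<Rightarrow> real \<Rightarrow> real"
    and H :: "(real \<Rightarrow> real) set"
    and ip :: "(real \<Rightarrow> real) \<Rightarrow> (real \<Rightarrow> real) \<Rightarrow> real"
  assumes T: "T = {0..} \<or> T = {0..<1}"
    and K: "\<And>s t. s \<in> T \<Longrightarrow> t \<in> T \<Longrightarrow> K s t = min s t"
    and rkhs: "rkhs T H ip K"
  shows "\<not> (\<exists>S. S \<subseteq> T \<and> countable S
      \<and> subtopology (top_of_set T) S = discrete_topology S
      \<and> inner_product_function_space.dense_in_space H ip
          (fun_space.span (kernel_section T K ` S)))"
proof clarify
  interpret rkhs T H ip K by (fact rkhs)
  fix S
  assume S: "S \<subseteq> T" and discrete: "subtopology (top_of_set T) S = discrete_topology S"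
    and dense: "dense_in_space (fun_space.span (kernel_section T K ` S))"
  obtain a b where ab: "a \<in> T" "b \<in> T" "a < b" "S \<inter> {a<..<b} = {}"
    using discrete_misses_interval[OF T S discrete] .
  define m where "m = (a + b) / 2"
  have m: "a < m" "m < b" "m \<in> T"
    using ab T by (auto simp: m_def)
  let ?k = "kernel_section T K"
  define f where "f = ?k a + fun_scale (-2) (?k m) + ?k b"
  have f: "f \<in> H"
    unfolding f_def using ab m section_in subspace
    by (intro fun_space.subspace_add fun_space.subspace_scale) auto
  have f_eq: "f t = min t a - 2 * min t m + min t b" if "t \<in> T" for t
    using that ab m K by (simp add: f_def fun_scale_def kernel_section_def)
  have "f s = 0" if "s \<in> S" for s
  proof -
    have "s \<in> T" "s \<le> a \<or> b \<le> s"
      using that S ab by (auto simp: not_less disjoint_iff)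
    \<comment> \<open>Left of \<open>a\<close> the three minima give \<open>s - 2 * s + s\<close>;
      right of \<open>b\<close> they give \<open>a - 2 * m + b\<close>, which is zero because
      \<open>m\<close> is the midpoint.\<close>
    then show ?thesis
      using m by (auto simp: f_eq min_def m_def field_simps)
  qed
  then have "f = 0"
    using vanishing_imp_zero[OF S dense f] by blast
  \<comment> \<open>The value at \<open>m\<close> is \<open>a - m\<close>, which is negative: the
    tent points downwards.\<close>
  then show False
    using f_eq[OF m(3)] m by (simp add: min_def split: if_splits)
qed

end
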